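(* Let $G$ be a connected graph of order $n\ge 2$ and let $\mathcal{H}=\{H_1,\dots,H_n\}$ be a family of $n$ connected non-trivial graphs, where $V_i$ denotes the vertex set of $H_i$. If $G\odot\mathcal{H}$ is $k'$-metric dimensional, then for every $k\in\{1,\dots,k'\}$, $$\sum_{i=1}^{n}\dim_k(H_i)\le \dim_k(G\odot\mathcal{H})\le\sum_{i=1}^{n}|V_i|.$$
   Context: All graphs are finite, simple and undirected; a graph is non-trivial if it has at least two vertices. For a connected graph $\Gamma$, $d_\Gamma(x,y)$ is the length of a shortest path between $x$ and $y$. For a positive integer $k$, a set $S\subseteq V(\Gamma)$ is a $k$-metric generator for $\Gamma$ if for any two different vertices $u,v$ of $\Gamma$ there are at least $k$ vertices $w\in S$ with $d_\Gamma(u,w)\neq d_\Gamma(v,w)$. A $k$-metric basis is a $k$-metric generator of minimum cardinality, and its cardinality is the $k$-metric dimension $\dim_k(\Gamma)$. A connected graph is $k'$-metric dimensional if $k'$ is the largest integer for which a $k'$-metric basis exists. Corona product: if $G$ has vertices $v_1,\dots,v_n$ and $\mathcal{H}=\{H_1,\dots,H_n\}$ is a family of $n$ graphs (repetitions up to isomorphism allowed), $G\odot\mathcal{H}$ is obtained from the disjoint union of $G$ and $H_1,\dots,H_n$ by joining, for each $i$, the vertex $v_i$ by an edge to every vertex of $H_i$. *)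

theory Defs
  imports "Graph_Theory.Graph_Theory" "HOL-Library.Extended_Nat"
begin

text \<open>
  Finite simple undirected graphs are the library's \<^locale>\<open>pair_graph\<close>: finite, loop-free digraphs
  with a symmetric arc set, every edge being represented by its two opposite arcs.
\<close>

text \<open>
  Only meaningful if \<^term>\<open>u\<close> and \<^term>\<open>v\<close> are joined by a path, in particular in connected graphs.
\<close>

definition graph_dist :: "'a pair_pre_digraph \<Rightarrow> 'a \<Rightarrow> 'a \<Rightarrow> nat" where
  "graph_dist G u v = (LEAST n. \<exists>p. pre_digraph.apath (with_proj G) u p v \<and> length p = n)"

definition k_metric_generator :: "nat \<Rightarrow> 'a pair_pre_digraph \<Rightarrow> 'a set \<Rightarrow> bool" where
  "k_metric_generator k G S \<longleftrightarrow> S \<subseteq> pverts G \<and>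
     (\<forall>u\<in>pverts G. \<forall>v\<in>pverts G. u \<noteq> v \<longrightarrow>
        k \<le> card {w \<in> S. graph_dist G u w \<noteq> graph_dist G v w})"

definition k_metric_basis :: "nat \<Rightarrow> 'a pair_pre_digraph \<Rightarrow> 'a set \<Rightarrow> bool" where
  "k_metric_basis k G S \<longleftrightarrow> k_metric_generator k G S \<and>
     (\<forall>T. k_metric_generator k G T \<longrightarrow> card S \<le> card T)"

text \<open>
  All bases have the same cardinality, so the infimum is that common value; it is \<^term>\<open>\<infinity>\<close> exactly
  if there is no basis. Hence a finite upper bound on the dimension includes the existence of a basis.
\<close>

definition k_metric_dim :: "nat \<Rightarrow> 'a pair_pre_digraph \<Rightarrow> enat" where
  "k_metric_dim k G = (INF S \<in> {S. k_metric_basis k G S}. enat (card S))"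

definition k_metric_dimensional :: "nat \<Rightarrow> 'a pair_pre_digraph \<Rightarrow> bool" where
  "k_metric_dimensional k G \<longleftrightarrow> 0 < k \<and> (\<exists>S. k_metric_basis k G S) \<and>
     (\<forall>j. (\<exists>S. k_metric_basis j G S) \<longrightarrow> j \<le> k)"

text \<open>
  The family is indexed by the vertices of \<^term>\<open>G\<close>. In the disjoint union, \<^term>\<open>Inl v\<close> is the
  vertex \<^term>\<open>v\<close> of \<^term>\<open>G\<close> and \<^term>\<open>Inr (v, x)\<close> is the vertex \<^term>\<open>x\<close> of \<^term>\<open>H v\<close>.
\<close>

definition corona ::
    "'a pair_pre_digraph \<Rightarrow> ('a \<Rightarrow> 'b pair_pre_digraph) \<Rightarrow> ('a + 'a \<times> 'b) pair_pre_digraph" where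
  "corona G H = \<lparr>
     pverts = Inl ` pverts G \<union> {Inr (v, x) | v x. v \<in> pverts G \<and> x \<in> pverts (H v)},
     parcs = {(Inl u, Inl v) | u v. (u, v) \<in> parcs G}
       \<union> {(Inr (v, x), Inr (v, y)) | v x y. v \<in> pverts G \<and> (x, y) \<in> parcs (H v)}
       \<union> {(Inl v, Inr (v, x)) | v x. v \<in> pverts G \<and> x \<in> pverts (H v)}
       \<union> {(Inr (v, x), Inl v) | v x. v \<in> pverts G \<and> x \<in> pverts (H v)} \<rparr>"

lemma pair_graph_corona:
  assumes G: "pair_graph G" and H: "\<And>v. v \<in> pverts G \<Longrightarrow> pair_graph (H v)"
  shows "pair_graph (corona G H)"
proof -
  interpret G: pair_graph G by (rule G)
  have wf: "x \<in> pverts (H v)" "y \<in> pverts (H v)" "x \<noteq> y" "(y, x) \<in> parcs (H v)"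
    if "v \<in> pverts G" "(x, y) \<in> parcs (H v)" for v x y
  proof -
    interpret Hv: pair_graph "H v" using H that(1) .
    show "x \<in> pverts (H v)" "y \<in> pverts (H v)"
      using that(2) by (auto dest: Hv.in_arcsD1 Hv.in_arcsD2)
    show "x \<noteq> y" using Hv.pair_no_loops[OF that(2)] by simp
    show "(y, x) \<in> parcs (H v)"
      using Hv.pair_sym_arcs that(2) by (auto simp: symmetric_def dest: symD)
  qed
  have fin: "finite (pverts (H v))" if "v \<in> pverts G" for v
    using pair_fin_digraph.pair_finite_verts[of "H v"] H[OF that]
    by (simp add: pair_graph_def pair_digraph_def)
  have "finite (Inr ` Sigma (pverts G) (\<lambda>v. pverts (H v)) :: ('a + 'a \<times> 'b) set)"
    using fin by (intro finite_imageI finite_SigmaI) auto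
  also have "Inr ` Sigma (pverts G) (\<lambda>v. pverts (H v)) =
      {Inr (v, x) :: 'a + 'a \<times> 'b | v x. v \<in> pverts G \<and> x \<in> pverts (H v)}" by auto
  finally have finV: "finite (pverts (corona G H))" by (simp add: corona_def)
  have "parcs (corona G H) \<subseteq> pverts (corona G H) \<times> pverts (corona G H)"
    by (auto simp: corona_def dest: wf(1,2) G.in_arcsD1 G.in_arcsD2)
  then have finA: "finite (parcs (corona G H))" using finV by (meson finite_SigmaI finite_subset)
  have sym: "(v, u) \<in> parcs G" if "(u, v) \<in> parcs G" for u v
    using G.pair_sym_arcs that by (auto simp: symmetric_def dest: symD)
  show ?thesis
  proof
    show "symmetric (with_proj (corona G H))"
      unfolding symmetric_def by (rule symI) (auto simp: corona_def dest: wf(4) sym)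
  qed (use finV finA in \<open>auto simp: corona_def dest: wf(1-3) G.in_arcsD1 G.in_arcsD2 G.pair_no_loops\<close>)
qed

end

theory Submission
  imports Defs
begin

text \<open>
  Write \<open>C\<close> for the corona product and \<open>V\<^sub>v\<close> for the copy of \<open>H v\<close> in \<open>C\<close>. A walk that leaves \<open>V\<^sub>v\<close>
  must do so through \<open>v\<close>, and \<open>v\<close> is adjacent to all of \<open>V\<^sub>v\<close>. This has two consequences for
  distances. A vertex of \<open>V\<^sub>v\<close> is one step further than \<open>v\<close> from anything outside \<open>V\<^sub>v\<close>
  (\<open>dist_from_copy\<close>), and inside \<open>V\<^sub>v\<close> the detour through \<open>v\<close> cuts every distance of \<open>H v\<close> down to
  at most 2 (\<open>dist_within_copy\<close>). So two vertices of the same copy can be told apart only by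
  vertices of that copy, and any vertex that tells them apart in \<open>C\<close> also does so in \<open>H v\<close>.

  Lower bound: by the last remark, a \<open>k\<close>-metric generator of \<open>C\<close> meets each \<open>V\<^sub>v\<close> in a \<open>k\<close>-metric
  generator of \<open>H v\<close>, and the copies are disjoint.

  Upper bound: the union of all copies is a \<open>k\<close>-metric generator. For two vertices of one copy it
  contains everything that can tell them apart, so it resolves them as often as any generator of
  \<open>C\<close> does. Any other two vertices are told apart by all vertices of some copy
  (\<open>some_copy_resolves\<close>), and every copy has at least \<open>k\<close> vertices: it has two vertices, and only
  the copy itself can supply the \<open>k\<close> vertices that tell them apart.
\<close>

section \<open>Distances in connected graphs\<close>

text \<open>
  Cutting cycles out of a walk does not lengthen it, so distances may be computed with walks, which
  unlike paths can be extended freely.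
\<close>

lemma (in wf_digraph) length_awalk_to_apath:
  assumes "awalk u p v"
  shows "length (awalk_to_apath p) \<le> length p"
  using assms
proof (induct rule: awalk_to_apath_induct)
  case (path p)
  then show ?case by (auto simp: awalk_to_apath.simps)
next
  case (decomp p q r s)
  then have "is_awalk_cyc_decomp p (q, r, s)"
    using awalk_cyc_decomp_has_prop[of u p v] by simp
  then have "length (q @ s) \<le> length p" by auto
  then show ?case using decomp step_awalk_to_apath[of u p v q r s] by simp
qed

context pair_wf_digraph
begin

lemma awalk_length_iff_relpow:
  "u \<in> pverts G \<Longrightarrow> (\<exists>p. awalk u p v \<and> length p = n) \<longleftrightarrow> (u, v) \<in> parcs G ^^ n"
proof (induct n arbitrary: u)
  case 0
  then show ?case by (auto simp: awalk_Nil_iff)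
next
  case (Suc n)
  show ?case
  proof
    assume "\<exists>p. awalk u p v \<and> length p = Suc n"
    then obtain e p where "awalk u (e # p) v" "length p = n" by (auto simp: length_Suc_conv)
    then have e: "e \<in> parcs G" "fst e = u" "awalk (snd e) p v" by (auto simp: awalk_Cons_iff)
    then have "(snd e, v) \<in> parcs G ^^ n"
      using Suc(1)[of "snd e"] \<open>length p = n\<close> arc_snd_in_verts by blast
    then show "(u, v) \<in> parcs G ^^ Suc n"
      using e by (metis prod.collapse relpow_Suc_I2)
  next
    assume "(u, v) \<in> parcs G ^^ Suc n"
    then obtain x where x: "(u, x) \<in> parcs G" "(x, v) \<in> parcs G ^^ n" by (blast dest: relpow_Suc_D2)
    then obtain p where "awalk x p v" "length p = n" using Suc(1) in_arcsD2 by blast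
    then show "\<exists>p. awalk u p v \<and> length p = Suc n"
      using x by (intro exI[of _ "(u, x) # p"]) (auto simp: awalk_Cons_iff)
  qed
qed

lemma graph_dist_eq_Least_relpow:
  assumes "u \<in> pverts G"
  shows "graph_dist G u v = (LEAST n. (u, v) \<in> parcs G ^^ n)"
proof -
  let ?A = "\<lambda>n. \<exists>p. apath u p v \<and> length p = n" and ?R = "\<lambda>n. (u, v) \<in> parcs G ^^ n"
  have A_imp_R: "?R n" if "?A n" for n
    using that awalk_length_iff_relpow[OF assms, of v n] by (auto dest: awalkI_apath)
  have R_imp_A: "\<exists>m\<le>n. ?A m" if R: "?R n" for n
  proof -
    obtain p where p: "awalk u p v" "length p = n"
      using R awalk_length_iff_relpow[OF assms, of v n] by auto
    show ?thesis
      using apath_awalk_to_apath[OF p(1)] length_awalk_to_apath[OF p(1)] p(2) by blast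
  qed
  show ?thesis
  proof (cases "\<exists>n. ?R n")
    case True
    then have R: "?R (Least ?R)" by (auto intro: LeastI_ex)
    then obtain m where m: "m \<le> Least ?R" "?A m" using R_imp_A by blast
    then have "m = Least ?R" using A_imp_R[OF m(2)] Least_le[of ?R m] by simp
    then have "?A (Least ?R)" using m by simp
    then have "Least ?A = Least ?R"
      by (rule Least_equality) (blast intro: Least_le A_imp_R)
    then show ?thesis by (simp add: graph_dist_def)
  next
    case False
    then have "?A = ?R" using A_imp_R by blast
    then show ?thesis by (simp add: graph_dist_def)
  qed
qed

end

locale connected_pair_graph = pair_graph +
  assumes conn: "Digraph_Component.connected (with_proj G)"
begin

lemma graph_dist_le:
  assumes "u \<in> pverts G" "(u, v) \<in> parcs G ^^ n"
  shows "graph_dist G u v \<le> n"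
  using assms by (simp add: graph_dist_eq_Least_relpow Least_le)

lemma shortest_walk:
  assumes "u \<in> pverts G" "v \<in> pverts G"
  shows "(u, v) \<in> parcs G ^^ graph_dist G u v"
proof -
  have "strongly_connected (with_proj G)"
    using symmetric_connected_imp_strongly_connected pair_sym_arcs conn by simp
  then have "u \<rightarrow>\<^sup>*\<^bsub>with_proj G\<^esub> v" using assms by auto
  then have "\<exists>n. (u, v) \<in> parcs G ^^ n"
    using reachable_rtranclI rtrancl_imp_relpow by fastforce
  then show ?thesis
    using assms by (auto simp: graph_dist_eq_Least_relpow intro: LeastI_ex)
qed

lemma sym_arc: "(u, v) \<in> parcs G \<Longrightarrow> (v, u) \<in> parcs G"
  using pair_sym_arcs by (auto simp: symmetric_def dest: symD)

lemma relpow_sym: "(u, v) \<in> parcs G ^^ n \<Longrightarrow> (v, u) \<in> parcs G ^^ n"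
proof (induct n arbitrary: v)
  case (Suc n)
  then obtain x where "(u, x) \<in> parcs G ^^ n" "(x, v) \<in> parcs G" by auto
  then show ?case using Suc(1) sym_arc by (blast intro: relpow_Suc_I2)
qed simp

lemma graph_dist_commute:
  assumes "u \<in> pverts G" "v \<in> pverts G"
  shows "graph_dist G u v = graph_dist G v u"
  using assms by (intro antisym graph_dist_le) (auto intro: relpow_sym[OF shortest_walk])

lemma graph_dist_eq_0_iff:
  assumes "u \<in> pverts G" "v \<in> pverts G"
  shows "graph_dist G u v = 0 \<longleftrightarrow> u = v"
  using shortest_walk[OF assms] graph_dist_le[OF assms(1), of v 0] by auto

lemma graph_dist_eq_1_iff:
  assumes "u \<in> pverts G" "v \<in> pverts G"
  shows "graph_dist G u v = 1 \<longleftrightarrow> (u, v) \<in> parcs G"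
proof
  assume "graph_dist G u v = 1"
  then show "(u, v) \<in> parcs G" using shortest_walk[OF assms] by simp
next
  assume arc: "(u, v) \<in> parcs G"
  then have "graph_dist G u v \<le> 1" using graph_dist_le[OF assms(1), of v 1] by simp
  moreover have "graph_dist G u v \<noteq> 0"
    using graph_dist_eq_0_iff[OF assms] pair_no_loops[OF arc] by simp
  ultimately show "graph_dist G u v = 1" by linarith
qed

end

section \<open>Distances in a corona product\<close>

locale connected_corona =
  fixes G :: "'a pair_pre_digraph" and H :: "'a \<Rightarrow> 'b pair_pre_digraph"
  assumes G: "connected_pair_graph G"
    and H: "\<And>v. v \<in> pverts G \<Longrightarrow> connected_pair_graph (H v)"
begin

abbreviation "C \<equiv> corona G H"

definition copy :: "'a \<Rightarrow> ('a + 'a \<times> 'b) set" where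
  "copy v = (\<lambda>x. Inr (v, x)) ` pverts (H v)"

lemma verts_corona: "pverts C = Inl ` pverts G \<union> (\<Union>v\<in>pverts G. copy v)"
  by (auto simp: corona_def copy_def)

lemma Inl_in_verts [simp]: "Inl v \<in> pverts C \<longleftrightarrow> v \<in> pverts G"
  by (auto simp: corona_def)

lemma Inr_in_verts [simp]: "Inr (v, x) \<in> pverts C \<longleftrightarrow> v \<in> pverts G \<and> x \<in> pverts (H v)"
  by (auto simp: corona_def)

lemma Inr_in_copy [simp]: "Inr (v, x) \<in> copy u \<longleftrightarrow> v = u \<and> x \<in> pverts (H v)"
  by (auto simp: copy_def)

lemma Inl_notin_copy [simp]: "Inl v \<notin> copy u"
  by (auto simp: copy_def)

lemma spoke:
  assumes "v \<in> pverts G" "x \<in> pverts (H v)"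
  shows "(Inl v, Inr (v, x)) \<in> parcs C" "(Inr (v, x), Inl v) \<in> parcs C"
  using assms by (auto simp: corona_def)

lemma arc_from_copy:
  assumes "(Inr (v, x), b) \<in> parcs C"
  obtains "b = Inl v" | y where "b = Inr (v, y)" "(x, y) \<in> parcs (H v)"
  using assms by (auto simp: corona_def)

lemma arc_within_copy_iff:
  "v \<in> pverts G \<Longrightarrow> (Inr (v, x), Inr (v, y)) \<in> parcs C \<longleftrightarrow> (x, y) \<in> parcs (H v)"
  by (auto simp: corona_def)

lemma connected_corona: "connected_pair_graph C"
proof -
  interpret G: connected_pair_graph G by (rule G)
  have "pair_graph C"
    by (intro pair_graph_corona G.pair_graph_axioms connected_pair_graph.axioms(1) H)
  interpret C: pair_graph C by fact
  have base: "(Inl u, Inl v) \<in> (parcs C)\<^sup>*" if "u \<in> pverts G" "v \<in> pverts G" for u v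
  proof -
    have "(Inl u, Inl w) \<in> parcs C ^^ n" if "(u, w) \<in> parcs G ^^ n" for n w
      using that
    proof (induct n arbitrary: w)
      case (Suc n)
      then obtain x where "(u, x) \<in> parcs G ^^ n" "(x, w) \<in> parcs G" by auto
      moreover from this have "(Inl x, Inl w) \<in> parcs C" by (auto simp: corona_def)
      ultimately show ?case using Suc(1) by auto
    qed simp
    then show ?thesis using G.shortest_walk that relpow_imp_rtrancl by metis
  qed
  have to_base: "\<exists>v\<in>pverts G. (a, Inl v) \<in> (parcs C)\<^sup>* \<and> (Inl v, a) \<in> (parcs C)\<^sup>*"
    if a: "a \<in> pverts C" for a
  proof (cases a)
    case (Inl v)
    then show ?thesis using a by auto
  next
    case (Inr z)
    then obtain v x where "a = Inr (v, x)" "v \<in> pverts G" "x \<in> pverts (H v)"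
      using a by (cases z) auto
    then show ?thesis using spoke by blast
  qed
  have "(a, b) \<in> (parcs C)\<^sup>*" if "a \<in> pverts C" "b \<in> pverts C" for a b
    using to_base[OF that(1)] to_base[OF that(2)] base by (meson rtrancl_trans)
  then have "a \<rightarrow>\<^sup>*\<^bsub>with_proj C\<^esub> b" if "a \<in> pverts C" "b \<in> pverts C" for a b
    using that by (simp add: C.reachable_conv)
  moreover have "pverts C \<noteq> {}"
    using G.conn by (auto simp: connected_conv corona_def)
  ultimately have "Digraph_Component.connected (with_proj C)"
    using C.connectedI C.reachable_mk_symmetricI by simp
  then show ?thesis
    by (intro connected_pair_graph.intro connected_pair_graph_axioms.intro \<open>pair_graph C\<close>)
qed

sublocale C: connected_pair_graph C
  by (rule connected_corona)

abbreviation d :: "('a + 'a \<times> 'b) \<Rightarrow> ('a + 'a \<times> 'b) \<Rightarrow> nat" where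
  "d \<equiv> graph_dist C"

text \<open>
  The only way out of a copy is its base vertex. A walk may stay inside the copy for a while before
  it leaves, so all that is known of the rest of the walk is that it is shorter.
\<close>

lemma walk_from_copy_via_base:
  assumes "(Inr (v, x), b) \<in> parcs C ^^ n" "b \<notin> copy v" "v \<in> pverts G" "x \<in> pverts (H v)"
  shows "\<exists>m<n. (Inl v, b) \<in> parcs C ^^ m"
  using assms
proof (induct n arbitrary: x)
  case 0
  then show ?case by auto
next
  case (Suc n)
  then obtain c where c: "(Inr (v, x), c) \<in> parcs C" "(c, b) \<in> parcs C ^^ n"
    by (blast dest: relpow_Suc_D2)
  from c(1) show ?case
  proof (cases rule: arc_from_copy)
    case 1
    then show ?thesis using c by blast
  next
    case (2 y)
    interpret Hv: connected_pair_graph "H v" using H Suc by blast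
    show ?thesis using 2 c Suc Hv.in_arcsD2 less_SucI by blast
  qed
qed

lemma dist_from_copy:
  assumes "v \<in> pverts G" "x \<in> pverts (H v)" "b \<in> pverts C" "b \<notin> copy v"
  shows "d (Inr (v, x)) b = Suc (d (Inl v) b)"
proof (rule antisym)
  have "(Inl v, b) \<in> parcs C ^^ d (Inl v) b" using assms by (intro C.shortest_walk) auto
  then have "(Inr (v, x), b) \<in> parcs C ^^ Suc (d (Inl v) b)"
    using spoke(2) assms by (blast intro: relpow_Suc_I2)
  then show "d (Inr (v, x)) b \<le> Suc (d (Inl v) b)" using assms by (intro C.graph_dist_le) auto
next
  have "(Inr (v, x), b) \<in> parcs C ^^ d (Inr (v, x)) b" using assms by (intro C.shortest_walk) auto
  then obtain m where "m < d (Inr (v, x)) b" "(Inl v, b) \<in> parcs C ^^ m"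
    using walk_from_copy_via_base assms by blast
  then show "Suc (d (Inl v) b) \<le> d (Inr (v, x)) b"
    using C.graph_dist_le[of "Inl v" b m] assms by simp
qed

lemma dist_base_copy:
  assumes "v \<in> pverts G" "x \<in> pverts (H v)"
  shows "d (Inl v) (Inr (v, x)) = 1"
  using C.graph_dist_eq_1_iff[of "Inl v" "Inr (v, x)"] assms spoke by simp

lemma dist_within_copy:
  assumes v: "v \<in> pverts G" and x: "x \<in> pverts (H v)" and y: "y \<in> pverts (H v)"
  shows "d (Inr (v, x)) (Inr (v, y)) = min 2 (graph_dist (H v) x y)"
proof -
  interpret Hv: connected_pair_graph "H v" using H v .
  have "(Inr (v, x), Inr (v, y)) \<in> parcs C ^^ 2"
    using spoke[OF v] x y by (auto simp: numeral_2_eq_2)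
  then have "d (Inr (v, x)) (Inr (v, y)) \<le> 2" using v x by (intro C.graph_dist_le) auto
  moreover have "d (Inr (v, x)) (Inr (v, y)) = 0 \<longleftrightarrow> graph_dist (H v) x y = 0"
    using C.graph_dist_eq_0_iff Hv.graph_dist_eq_0_iff v x y by simp
  moreover have "d (Inr (v, x)) (Inr (v, y)) = 1 \<longleftrightarrow> graph_dist (H v) x y = 1"
    using C.graph_dist_eq_1_iff Hv.graph_dist_eq_1_iff arc_within_copy_iff v x y by simp
  ultimately show ?thesis by linarith
qed

section \<open>Which vertices of a corona product tell two vertices apart\<close>

lemma resolver_within_copy:
  assumes "v \<in> pverts G" "x \<in> pverts (H v)" "y \<in> pverts (H v)" "w \<in> pverts C"
    and "d (Inr (v, x)) w \<noteq> d (Inr (v, y)) w"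
  obtains z where "w = Inr (v, z)" "z \<in> pverts (H v)" "graph_dist (H v) x z \<noteq> graph_dist (H v) y z"
proof -
  have "w \<in> copy v" using dist_from_copy assms by metis
  then obtain z where z: "w = Inr (v, z)" "z \<in> pverts (H v)" by (auto simp: copy_def)
  then have "graph_dist (H v) x z \<noteq> graph_dist (H v) y z"
    using dist_within_copy assms by metis
  then show thesis using that z by blast
qed

text \<open>
  The copy to be used depends on the pair. A base vertex is at distance 1 from its own copy, while
  anything else outside that copy is at distance at least 2 from it. Two vertices of different
  copies are told apart by either of the two copies: its own vertices are within distance 2 of it,
  the others at least at distance 3. There remain \<open>v\<close> and a vertex of its own copy; any other copy
  is closer to \<open>v\<close> by one, and this is where two vertices of \<open>G\<close> are needed.
\<close>

lemma some_copy_resolves: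
  assumes order: "2 \<le> card (pverts G)"
    and a: "a \<in> pverts C" and b: "b \<in> pverts C" and ne: "a \<noteq> b"
    and not_same: "\<And>v. v \<in> pverts G \<Longrightarrow> \<not> (a \<in> copy v \<and> b \<in> copy v)"
  shows "\<exists>v\<in>pverts G. \<forall>w\<in>copy v. d a w \<noteq> d b w"
proof -
  have base_vs_far: "d (Inl v) w \<noteq> d b w"
    if A: "v \<in> pverts G" "b \<in> pverts C" "b \<noteq> Inl v" "b \<notin> copy v" "w \<in> copy v" for v b w
  proof -
    obtain z where z: "w = Inr (v, z)" "z \<in> pverts (H v)" using A by (auto simp: copy_def)
    have "d b w = Suc (d (Inl v) b)"
      using dist_from_copy[of v z b] C.graph_dist_commute[of b w] A z by simp
    moreover have "d (Inl v) b \<noteq> 0" using C.graph_dist_eq_0_iff A by auto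
    ultimately show ?thesis using dist_base_copy A z by simp
  qed
  have base_vs_own: "\<exists>u\<in>pverts G. \<forall>w\<in>copy u. d (Inl v) w \<noteq> d (Inr (v, y)) w"
    if v: "v \<in> pverts G" and y: "y \<in> pverts (H v)" for v y
  proof -
    have "pverts G \<noteq> {v}" using order by auto
    then obtain u where u: "u \<in> pverts G" "u \<noteq> v" using v by blast
    have "d (Inl v) w \<noteq> d (Inr (v, y)) w" if "w \<in> copy u" for w
    proof -
      have "w \<in> pverts C" "w \<notin> copy v" using that u by (auto simp: copy_def)
      then show ?thesis using dist_from_copy v y by simp
    qed
    then show ?thesis using u by blast
  qed
  have copies: "d (Inr (v, x)) w \<noteq> d (Inr (u, y)) w"
    if A: "v \<in> pverts G" "u \<in> pverts G" "u \<noteq> v" "x \<in> pverts (H v)" "y \<in> pverts (H u)" "w \<in> copy v"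
    for v u x y w
  proof -
    obtain z where z: "w = Inr (v, z)" "z \<in> pverts (H v)" using A by (auto simp: copy_def)
    have "d (Inr (u, y)) w = Suc (d (Inl u) w)" using dist_from_copy A z by simp
    also have "d (Inl u) w = Suc (d (Inl v) (Inl u))"
      using dist_from_copy[of v z "Inl u"] C.graph_dist_commute[of "Inl u" w] A z by simp
    finally have "d (Inr (u, y)) w = Suc (Suc (d (Inl v) (Inl u)))" .
    moreover have "d (Inl v) (Inl u) \<noteq> 0" using C.graph_dist_eq_0_iff A by auto
    ultimately show ?thesis using dist_within_copy[of v x z] A z by simp
  qed
  consider (bb) v u where "a = Inl v" "b = Inl u" "v \<in> pverts G" "u \<in> pverts G"
    | (bc) v u y where "a = Inl v" "b = Inr (u, y)" "v \<in> pverts G" "u \<in> pverts G" "y \<in> pverts (H u)"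
    | (cb) v u y where "b = Inl v" "a = Inr (u, y)" "v \<in> pverts G" "u \<in> pverts G" "y \<in> pverts (H u)"
    | (cc) v x u y where "a = Inr (v, x)" "b = Inr (u, y)" "v \<in> pverts G" "u \<in> pverts G"
        "x \<in> pverts (H v)" "y \<in> pverts (H u)"
    using a b by (auto simp: corona_def)
  then show ?thesis
  proof cases
    case bb
    then show ?thesis using base_vs_far[of v b] b ne by (intro bexI[of _ v]) auto
  next
    case bc
    then show ?thesis using base_vs_far[of v b] base_vs_own[of v y] b by (cases "u = v") auto
  next
    case cb
    show ?thesis
    proof (cases "u = v")
      case True
      then show ?thesis using base_vs_own[of v y] cb by metis
    next
      case False
      then have "a \<notin> copy v" "a \<noteq> Inl v" using cb by auto
      then show ?thesis using base_vs_far[of v a] a cb by metis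
    qed
  next
    case cc
    then have "u \<noteq> v" using not_same[of v] by auto
    then show ?thesis using copies cc by blast
  qed
qed

end

section \<open>Generators and dimensions\<close>

text \<open>
  The dimension refers to bases only. Cardinalities are well-ordered, so once there is a generator
  there is also one of least cardinality, which is a basis.
\<close>

lemma k_metric_dim_le:
  assumes "k_metric_generator k G S"
  shows "k_metric_dim k G \<le> enat (card S)"
proof -
  obtain T where T: "k_metric_generator k G T"
    "\<And>T'. k_metric_generator k G T' \<Longrightarrow> card T \<le> card T'"
    using ex_has_least_nat[of "k_metric_generator k G" S card] assms by blast
  then have "k_metric_dim k G \<le> enat (card T)"
    unfolding k_metric_dim_def by (intro INF_lower) (auto simp: k_metric_basis_def)
  also have "\<dots> \<le> enat (card S)" using T(2) assms by simp
  finally show ?thesis .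
qed

context connected_corona
begin

lemma finite_G: "finite (pverts G)"
  using G connected_pair_graph.axioms pair_fin_digraph.pair_finite_verts
  by (auto simp: connected_pair_graph_def pair_graph_def pair_digraph_def)

lemma finite_H: "v \<in> pverts G \<Longrightarrow> finite (pverts (H v))"
  using H pair_fin_digraph.pair_finite_verts
  by (auto simp: connected_pair_graph_def pair_graph_def pair_digraph_def)

lemma finite_copy: "v \<in> pverts G \<Longrightarrow> finite (copy v)"
  by (simp add: copy_def finite_H)

lemma card_copy: "card (copy v) = card (pverts (H v))"
  by (simp add: copy_def card_image inj_on_def)

text \<open>
  Restricting a generator to a copy costs no pair of that copy any of its resolving vertices, since
  these all lie in the copy, and \<open>H v\<close> distinguishes at least as much as the corona product does.
\<close>

lemma generator_trace:
  assumes S: "k_metric_generator k C S" and v: "v \<in> pverts G"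
  shows "k_metric_generator k (H v) {z. Inr (v, z) \<in> S}"
  unfolding k_metric_generator_def
proof (intro conjI ballI impI)
  show "{z. Inr (v, z) \<in> S} \<subseteq> pverts (H v)"
    using S by (auto simp: k_metric_generator_def)
  fix x y assume xy: "x \<in> pverts (H v)" "y \<in> pverts (H v)" "x \<noteq> y"
  let ?R = "{z \<in> {z. Inr (v, z) \<in> S}. graph_dist (H v) x z \<noteq> graph_dist (H v) y z}"
  have S_verts: "S \<subseteq> pverts C" using S by (simp add: k_metric_generator_def)
  have "?R \<subseteq> pverts (H v)" using S_verts by auto
  then have fin: "finite ?R" using finite_H[OF v] finite_subset by blast
  have "k \<le> card {w \<in> S. d (Inr (v, x)) w \<noteq> d (Inr (v, y)) w}"
    using S v xy by (simp add: k_metric_generator_def)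
  also have "\<dots> \<le> card ((\<lambda>z. Inr (v, z) :: 'a + 'a \<times> 'b) ` ?R)"
  proof (rule card_mono)
    show "finite ((\<lambda>z. Inr (v, z) :: 'a + 'a \<times> 'b) ` ?R)" using fin by simp
    show "{w \<in> S. d (Inr (v, x)) w \<noteq> d (Inr (v, y)) w} \<subseteq> (\<lambda>z. Inr (v, z)) ` ?R"
    proof
      fix w assume w: "w \<in> {w \<in> S. d (Inr (v, x)) w \<noteq> d (Inr (v, y)) w}"
      then show "w \<in> (\<lambda>z. Inr (v, z)) ` ?R"
        using resolver_within_copy[OF v xy(1,2), of w] S_verts by blast
    qed
  qed
  also have "\<dots> = card ?R" by (simp add: card_image inj_on_def)
  finally show "k \<le> card ?R" .
qed

lemma sum_dim_le_card_generator:
  assumes S: "k_metric_generator k C S"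
  shows "(\<Sum>v\<in>pverts G. k_metric_dim k (H v)) \<le> enat (card S)"
proof -
  let ?S = "\<lambda>v. {z. Inr (v, z) \<in> S}"
  have S_verts: "S \<subseteq> pverts C" using S by (simp add: k_metric_generator_def)
  then have finS: "finite S" using C.pair_finite_verts finite_subset by blast
  have fin: "finite (?S v)" if "v \<in> pverts G" for v
    by (rule finite_subset[OF _ finite_H[OF that]]) (use S_verts in auto)
  have "(\<Sum>v\<in>pverts G. k_metric_dim k (H v)) \<le> (\<Sum>v\<in>pverts G. enat (card (?S v)))"
    by (intro sum_mono k_metric_dim_le generator_trace S)
  also have "\<dots> = enat (\<Sum>v\<in>pverts G. card (?S v))"
    using finite_G by (induct rule: finite_induct) (auto simp: zero_enat_def)
  also have "(\<Sum>v\<in>pverts G. card (?S v)) = card (SIGMA v:pverts G. ?S v)"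
    using finite_G fin by (simp add: card_SigmaI)
  also have "\<dots> = card ((Inr :: _ \<Rightarrow> 'a + 'a \<times> 'b) ` (SIGMA v:pverts G. ?S v))"
    by (simp add: card_image)
  also have "enat \<dots> \<le> enat (card S)"
    using card_mono[OF finS, of "Inr ` (SIGMA v:pverts G. ?S v)"] by auto
  finally show ?thesis .
qed

lemma resolvers_subset_copy:
  assumes v: "v \<in> pverts G" and ab: "a \<in> copy v" "b \<in> copy v" and S: "S \<subseteq> pverts C"
  shows "{w \<in> S. d a w \<noteq> d b w} \<subseteq> copy v"
proof
  fix w assume w: "w \<in> {w \<in> S. d a w \<noteq> d b w}"
  obtain x y where "a = Inr (v, x)" "x \<in> pverts (H v)" "b = Inr (v, y)" "y \<in> pverts (H v)"
    using ab unfolding copy_def by blast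
  moreover have "w \<in> pverts C" "d a w \<noteq> d b w" using w S by blast+
  ultimately obtain z where "w = Inr (v, z)" "z \<in> pverts (H v)"
    using resolver_within_copy[OF v] by metis
  then show "w \<in> copy v" by simp
qed

lemma generator_le_card_copy:
  assumes S: "k_metric_generator k C S" and v: "v \<in> pverts G" and card_H: "2 \<le> card (pverts (H v))"
  shows "k \<le> card (copy v)"
proof -
  obtain x y where xy: "x \<in> pverts (H v)" "y \<in> pverts (H v)" "x \<noteq> y"
    using card_H by (metis card_2_iff' obtain_subset_with_card_n subsetD)
  have "k \<le> card {w \<in> S. d (Inr (v, x)) w \<noteq> d (Inr (v, y)) w}"
    using S v xy by (simp add: k_metric_generator_def)
  also have "\<dots> \<le> card (copy v)"
  proof (rule card_mono[OF finite_copy[OF v] resolvers_subset_copy[OF v]])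
    show "S \<subseteq> pverts C" using S by (simp add: k_metric_generator_def)
  qed (use xy in simp_all)
  finally show ?thesis .
qed

lemma copies_generator:
  assumes S: "k_metric_generator k C S"
    and order: "2 \<le> card (pverts G)" and card_H: "\<And>v. v \<in> pverts G \<Longrightarrow> 2 \<le> card (pverts (H v))"
  shows "k_metric_generator k C (\<Union>v\<in>pverts G. copy v)"
  unfolding k_metric_generator_def
proof (intro conjI ballI impI)
  let ?U = "\<Union>v\<in>pverts G. copy v"
  have finU: "finite ?U" using finite_G finite_copy by blast
  show "?U \<subseteq> pverts C" by (auto simp: verts_corona)
  fix a b assume ab: "a \<in> pverts C" "b \<in> pverts C" "a \<noteq> b"
  have finR: "finite {w \<in> ?U. d a w \<noteq> d b w}"
    by (rule finite_subset[OF _ finU]) blast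
  show "k \<le> card {w \<in> ?U. d a w \<noteq> d b w}"
  proof (cases "\<exists>v\<in>pverts G. a \<in> copy v \<and> b \<in> copy v")
    case True
    then obtain v where v: "v \<in> pverts G" "a \<in> copy v" "b \<in> copy v" by blast
    have "S \<subseteq> pverts C" using S by (simp add: k_metric_generator_def)
    then have "{w \<in> S. d a w \<noteq> d b w} \<subseteq> {w \<in> ?U. d a w \<noteq> d b w}"
      using resolvers_subset_copy[OF v] v(1) by blast
    then have "card {w \<in> S. d a w \<noteq> d b w} \<le> card {w \<in> ?U. d a w \<noteq> d b w}"
      by (rule card_mono[OF finR])
    moreover have "k \<le> card {w \<in> S. d a w \<noteq> d b w}"
      using S ab by (simp add: k_metric_generator_def)
    ultimately show ?thesis by linarith
  next
    case False
    then obtain v where v: "v \<in> pverts G" "\<forall>w\<in>copy v. d a w \<noteq> d b w"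
      using some_copy_resolves[OF order ab] by blast
    have "k \<le> card (copy v)" using generator_le_card_copy S v(1) card_H by blast
    moreover have "copy v \<subseteq> {w \<in> ?U. d a w \<noteq> d b w}" using v by blast
    then have "card (copy v) \<le> card {w \<in> ?U. d a w \<noteq> d b w}"
      by (rule card_mono[OF finR])
    ultimately show ?thesis by linarith
  qed
qed

lemma card_copies: "card (\<Union>v\<in>pverts G. copy v) = (\<Sum>v\<in>pverts G. card (pverts (H v)))"
proof -
  have "card (\<Union>v\<in>pverts G. copy v) = (\<Sum>v\<in>pverts G. card (copy v))"
    using finite_G finite_copy by (intro card_UN_disjoint) (auto simp: copy_def)
  then show ?thesis by (simp add: card_copy)
qed

end

theorem theorem25:
  fixes G :: "'a pair_pre_digraph" and H :: "'a \<Rightarrow> 'b pair_pre_digraph" and k k' :: nat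
  assumes "pair_graph G" and "Digraph_Component.connected (with_proj G)" and "card (pverts G) \<ge> 2"
    and "\<And>v. v \<in> pverts G \<Longrightarrow> pair_graph (H v)"
    and "\<And>v. v \<in> pverts G \<Longrightarrow> Digraph_Component.connected (with_proj (H v))"
    and "\<And>v. v \<in> pverts G \<Longrightarrow> card (pverts (H v)) \<ge> 2"
    and "k_metric_dimensional k' (corona G H)"
    and "k \<in> {1..k'}"
  shows "(\<Sum>v\<in>pverts G. k_metric_dim k (H v)) \<le> k_metric_dim k (corona G H) \<and>
         k_metric_dim k (corona G H) \<le> enat (\<Sum>v\<in>pverts G. card (pverts (H v)))"
proof
  interpret connected_corona G H
    using assms(1,2,4,5)
    by (intro connected_corona.intro connected_pair_graph.intro connected_pair_graph_axioms.intro)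
  show "(\<Sum>v\<in>pverts G. k_metric_dim k (H v)) \<le> k_metric_dim k C"
    unfolding k_metric_dim_def[of k C]
    by (intro INF_greatest sum_dim_le_card_generator) (simp add: k_metric_basis_def)
  \<comment> \<open>Resolving every pair \<open>k'\<close> times includes resolving it \<open>k\<close> times.\<close>
  obtain S where "k_metric_generator k' C S"
    using assms(7) by (auto simp: k_metric_dimensional_def k_metric_basis_def)
  then have "k_metric_generator k C S"
    using assms(8) by (force simp: k_metric_generator_def)
  then have "k_metric_generator k C (\<Union>v\<in>pverts G. copy v)"
    using assms(3,6) by (rule copies_generator)
  then show "k_metric_dim k C \<le> enat (\<Sum>v\<in>pverts G. card (pverts (H v)))"
    using k_metric_dim_le card_copies by metis
qed

end
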